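(* Consider the nonlinear time-varying dynamical system $\dot x=f(t,x)$, with state $x\in\mathbb{R}^n$ and $f$ continuously differentiable in $x$, and let $$x(k+1)=x(k)+\varepsilon f(k,x(k)),\qquad k\in\mathbb{N},$$ denote its Euler discretization, with $\varepsilon>0$. Suppose that the trajectories of this discretized system evolve on a compact and convex set $\Omega\subset\mathbb{R}^n$, and that $$J(k,a):=I+\varepsilon\frac{\partial}{\partial x}f(k,a)$$ is tridiagonal, with positive entries on the super- and sub-diagonals, for all $k\in\mathbb{N}$ and all $a\in\Omega$. For $k\in\mathbb{N}$ and $a,b\in\Omega$ let $$F(k,a,b):=\int_0^1 J(k,ra+(1-r)b)\,\mathrm{d}r.$$ Then for any $\varepsilon>0$ sufficiently small the system $z(k+1)=F(k,\cdot,\cdot)z(k)$ is an oscillatory discrete-time system (ODTS) of order $n-1$.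
   Context: $\mathbb{N}=\{0,1,2,\dots\}$. A matrix is totally positive (TP) if all its minors are positive, and totally nonnegative (TN) if all its minors are nonnegative. A square matrix $A$ is oscillatory if it is TN and there is an integer $m\ge1$ such that $A^m$ is TP. A linear time-varying system $y(k+1)=A(k)y(k)$, with $A:\mathbb{N}\to\mathbb{R}^{n\times n}$, is called an ODTS of order $p$ if $A(k)$ is oscillatory for all $k\in\mathbb{N}$ and every product $A(k_p)\cdots A(k_2)A(k_1)$ with $0\le k_1<\dots<k_p$ is TP. For the system $z(k+1)=F(k,\cdot,\cdot)z(k)$ this is understood to hold for arbitrary choices in $\Omega$ of the last two arguments of $F$ (at each time): $F(k,a,b)$ is oscillatory for all $k\in\mathbb{N}$ and $a,b\in\Omega$, and every product $F(k_p,a_p,b_p)\cdots F(k_1,a_1,b_1)$ with $0\le k_1<\dots<k_p$ and $a_i,b_i\in\Omega$ is TP.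
   Formalization: The formal theorem also assumes that the Jacobians ∂f/∂x(k,a) are bounded uniformly over all k∈ℕ and a∈Ω; without this the claim fails, e.g. for f(t,x)=(t+1)[[0,1],[1,0]]x with Ω={0}. *)

theory Defs
  imports "HOL-Analysis.Analysis" "Jordan_Normal_Form.Determinant"
begin

no_notation Matrix.vec_index (infixl "$" 100)
hide_const (open) Matrix.mat Determinant.det

text \<open>
  Coordinates of \<open>real ^ 'n\<close> are indexed by a finite linearly ordered type (for instance a
  numeral type), so that adjacency of indices and the order of rows and columns make sense; up to
  an order isomorphism the index set is \<open>{0, ..., n - 1}\<close> with \<open>n = CARD('n)\<close>.
\<close>

definition pos :: "'i::{finite,linorder} \<Rightarrow> nat" where
  "pos i = card {j. j < i}"

text \<open>
  The order-\<open>q\<close> minor with rows \<open>r 0 < ... < r (q - 1)\<close> and columns \<open>c 0 < ... < c (q - 1)\<close>.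
  The determinant is that of matrices whose size is a natural number, not a type.
\<close>

definition minor ::
    "real ^ ('n::{finite,linorder}) ^ ('m::{finite,linorder})
      \<Rightarrow> nat \<Rightarrow> (nat \<Rightarrow> 'm) \<Rightarrow> (nat \<Rightarrow> 'n) \<Rightarrow> real" where
  "minor A q r c = Determinant.det (Matrix.mat q q (\<lambda>(i, j). A $ r i $ c j))"

definition totally_positive ::
    "real ^ ('n::{finite,linorder}) ^ ('m::{finite,linorder}) \<Rightarrow> bool" where
  "totally_positive A \<longleftrightarrow>
     (\<forall>q r c. 1 \<le> q \<and> strict_mono_on {..<q} r \<and> strict_mono_on {..<q} c \<longrightarrow> 0 < minor A q r c)"

definition totally_nonnegative ::
    "real ^ ('n::{finite,linorder}) ^ ('m::{finite,linorder}) \<Rightarrow> bool" where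
  "totally_nonnegative A \<longleftrightarrow>
     (\<forall>q r c. 1 \<le> q \<and> strict_mono_on {..<q} r \<and> strict_mono_on {..<q} c \<longrightarrow> 0 \<le> minor A q r c)"

text \<open>\<open>mat_prod A p = A p ** ... ** A 2 ** A 1\<close>; the factor \<open>A 0\<close> is not used.\<close>

primrec mat_prod :: "(nat \<Rightarrow> real ^ 'n ^ 'n) \<Rightarrow> nat \<Rightarrow> real ^ 'n ^ 'n" where
  "mat_prod A 0 = Finite_Cartesian_Product.mat 1"
| "mat_prod A (Suc p) = A (Suc p) ** mat_prod A p"

text \<open>Powers with respect to the matrix product (\<open>*\<close> is not the matrix product on this type).\<close>

abbreviation mat_pow :: "real ^ 'n ^ 'n \<Rightarrow> nat \<Rightarrow> real ^ 'n ^ 'n" where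
  "mat_pow A m \<equiv> mat_prod (\<lambda>_. A) m"

definition oscillatory :: "real ^ ('n::{finite,linorder}) ^ ('n::{finite,linorder}) \<Rightarrow> bool" where
  "oscillatory A \<longleftrightarrow>
     totally_nonnegative A \<and> (\<exists>m\<ge>1. totally_positive (mat_pow A m))"

text \<open>
  The system \<open>z (k + 1) = F k a b *v z k\<close>, where at each time \<open>a\<close> and \<open>b\<close> range over \<open>\<Omega>\<close>
  independently of the other times.
\<close>

definition ODTS ::
    "nat \<Rightarrow> 'p set \<Rightarrow> (nat \<Rightarrow> 'p \<Rightarrow> 'p \<Rightarrow> real ^ ('n::{finite,linorder}) ^ ('n::{finite,linorder})) \<Rightarrow> bool" where
  "ODTS p \<Omega> F \<longleftrightarrow>
     (\<forall>k. \<forall>a\<in>\<Omega>. \<forall>b\<in>\<Omega>. oscillatory (F k a b)) \<and>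
     (\<forall>\<kappa> \<alpha> \<beta>. strict_mono_on {1..p} \<kappa> \<and> (\<forall>i\<in>{1..p}. \<alpha> i \<in> \<Omega> \<and> \<beta> i \<in> \<Omega>)
        \<longrightarrow> totally_positive (mat_prod (\<lambda>i. F (\<kappa> i) (\<alpha> i) (\<beta> i)) p))"

definition tridiagonal :: "real ^ ('n::{finite,linorder}) ^ ('n::{finite,linorder}) \<Rightarrow> bool" where
  "tridiagonal A \<longleftrightarrow>
     (\<forall>i j. pos i + 1 < pos j \<or> pos j + 1 < pos i \<longrightarrow> A $ i $ j = 0)"

definition pos_off_diagonals :: "real ^ ('n::{finite,linorder}) ^ ('n::{finite,linorder}) \<Rightarrow> bool" where
  "pos_off_diagonals A \<longleftrightarrow>
     (\<forall>i j. pos j = pos i + 1 \<longrightarrow> 0 < A $ i $ j \<and> 0 < A $ j $ i)"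

definition C1_in_state :: "(real \<Rightarrow> real ^ 'n \<Rightarrow> real ^ 'n) \<Rightarrow> bool" where
  "C1_in_state f \<longleftrightarrow>
     (\<forall>t\<ge>0. (\<forall>x. f t differentiable (at x)) \<and> continuous_on UNIV (\<lambda>x. jacobian (f t) (at x)))"

definition euler_trajectory ::
    "real \<Rightarrow> (real \<Rightarrow> real ^ 'n \<Rightarrow> real ^ 'n) \<Rightarrow> (nat \<Rightarrow> real ^ 'n) \<Rightarrow> bool" where
  "euler_trajectory \<epsilon> f x \<longleftrightarrow> (\<forall>k. x (k + 1) = x k + \<epsilon> *\<^sub>R f (real k) (x k))"

definition euler_evolves_on ::
    "real \<Rightarrow> (real \<Rightarrow> real ^ 'n \<Rightarrow> real ^ 'n) \<Rightarrow> (real ^ 'n) set \<Rightarrow> bool" where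
  "euler_evolves_on \<epsilon> f \<Omega> \<longleftrightarrow>
     (\<forall>x. euler_trajectory \<epsilon> f x \<and> x 0 \<in> \<Omega> \<longrightarrow> (\<forall>k. x k \<in> \<Omega>))"

definition euler_jacobian ::
    "real \<Rightarrow> (real \<Rightarrow> real ^ 'n \<Rightarrow> real ^ 'n) \<Rightarrow> nat \<Rightarrow> real ^ 'n \<Rightarrow> real ^ 'n ^ 'n" where
  "euler_jacobian \<epsilon> f k a =
     Finite_Cartesian_Product.mat 1 + \<epsilon> *\<^sub>R jacobian (f (real k)) (at a)"

definition euler_mean_jacobian ::
    "real \<Rightarrow> (real \<Rightarrow> real ^ 'n \<Rightarrow> real ^ 'n) \<Rightarrow> nat \<Rightarrow> real ^ 'n \<Rightarrow> real ^ 'n \<Rightarrow> real ^ 'n ^ 'n"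
  where
  "euler_mean_jacobian \<epsilon> f k a b =
     integral {0..1} (\<lambda>r. euler_jacobian \<epsilon> f k (r *\<^sub>R a + (1 - r) *\<^sub>R b))"

text \<open>
  On a compact \<open>\<Omega>\<close> each \<open>jacobian (f (real k))\<close> is bounded by continuity; this is boundedness
  uniformly in \<open>k\<close>. It holds for instance when \<open>f\<close> is autonomous, or periodic in time with a
  period in \<open>\<nat>\<close>. Without it no step size need work for all times \<open>k\<close>: for
  \<open>f t (x, y) = (- x + arctan ((t + 1) * y), - y + arctan ((t + 1) * x))\<close> on \<open>\<Omega> = [-2, 2]\<^sup>2\<close>
  and \<open>0 < \<epsilon> < 1\<close>, the determinant of \<open>euler_mean_jacobian \<epsilon> f k 0 0\<close> is
  \<open>(1 - \<epsilon>)\<^sup>2 - \<epsilon>\<^sup>2 (k + 1)\<^sup>2\<close>, which is negative for large \<open>k\<close>.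
\<close>

definition jacobian_bounded_on ::
    "(real \<Rightarrow> real ^ 'n \<Rightarrow> real ^ 'n) \<Rightarrow> (real ^ 'n) set \<Rightarrow> bool" where
  "jacobian_bounded_on f \<Omega> \<longleftrightarrow> bounded {jacobian (f (real k)) (at a) | k a. a \<in> \<Omega>}"

end

theory Submission
  imports Defs
begin

text \<open>
  For small \<open>\<epsilon>\<close> every mean Jacobian is a tridiagonal matrix close to the identity with positive
  off-diagonal entries. A minor of such a matrix with rows \<open>r\<close> and columns \<open>c\<close> is positive when
  all indices satisfy \<open>\<bar>r i - c i\<bar> \<le> 1\<close>, by a continuant recursion along its last row or column,
  and otherwise vanishes because of a zero block. By the Cauchy--Binet formula a minor of a product
  of \<open>n - 1\<close> such matrices is a sum of nonnegative terms, one for each chain of index sets from \<open>r\<close>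
  to \<open>c\<close>. Moving every index by one towards its target gives a chain along which all factors are
  positive, since no index has to move further than \<open>n - 1\<close>.
\<close>

section \<open>Minors and the Cauchy--Binet formula\<close>

lemma minor_cong:
  assumes "\<And>i. i < q \<Longrightarrow> r i = r' i" "\<And>i. i < q \<Longrightarrow> c i = c' i"
  shows "minor A q r c = minor A q r' c'"
  unfolding minor_def using assms by (intro arg_cong[where f = Determinant.det] eq_matI) auto

lemma minor_transpose:
  "minor (Finite_Cartesian_Product.transpose A) q c r = minor A q r c"
proof -
  let ?M = "Matrix.mat q q (\<lambda>(i, j). A $ r i $ c j)"
  have "Matrix.mat q q (\<lambda>(i, j). Finite_Cartesian_Product.transpose A $ c i $ r j)
      = Matrix.transpose_mat ?M"
    by (intro eq_matI) (auto simp: Finite_Cartesian_Product.transpose_def)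
  then show ?thesis
    unfolding minor_def using det_transpose[of ?M q] by simp
qed

lemma minor_eq_sum_permutations:
  "minor A q r c = (\<Sum>p | p permutes {0..<q}. signof p * (\<Prod>i=0..<q. A $ r i $ c (p i)))"
  unfolding minor_def
  by (subst det_def'[of _ q])
    (auto intro!: sum.cong prod.cong arg_cong2[where f = "(*)"] simp: permutes_in_image)

lemma minor_permute_rows:
  assumes "p permutes {0..<q}"
  shows "minor A q (r \<circ> p) c = signof p * minor A q r c"
proof -
  let ?M = "Matrix.mat q q (\<lambda>(i, j). A $ r i $ c j)"
  have "Matrix.mat q q (\<lambda>(i, j). A $ (r \<circ> p) i $ c j)
      = Matrix.mat q q (\<lambda>(i, j). ?M $$ (p i, j))"
    using permutes_in_image[OF assms] by (intro eq_matI) auto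
  then show ?thesis
    unfolding minor_def using det_permute_rows[OF _ assms, of ?M] by simp
qed

lemma minor_permute_columns:
  assumes "p permutes {0..<q}"
  shows "minor A q r (c \<circ> p) = signof p * minor A q r c"
  using minor_permute_rows[OF assms, of "Finite_Cartesian_Product.transpose A" c r]
  by (simp add: minor_transpose)

lemma minor_not_inj_rows:
  assumes "\<not> inj_on r {0..<q}"
  shows "minor A q r c = 0"
proof -
  obtain i j where ij: "i < q" "j < q" "i \<noteq> j" "r i = r j"
    using assms by (auto simp: inj_on_def)
  show ?thesis
    unfolding minor_def
    by (rule det_identical_rows[of _ q i j]) (use ij in \<open>auto intro!: eq_vecI\<close>)
qed

text \<open>Multilinearity in the rows: row \<open>r i\<close> of \<open>A ** B\<close> is a
  combination of the rows of \<open>B\<close>, and \<open>f i\<close> is the row chosen for it when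
  the product over \<open>i\<close> is multiplied out.\<close>

lemma minor_matrix_mult:
  fixes A :: "real ^ 'k::{finite,linorder} ^ 'm::{finite,linorder}"
    and B :: "real ^ 'n::{finite,linorder} ^ 'k::{finite,linorder}"
  shows "minor (A ** B) q r c
    = (\<Sum>f \<in> {0..<q} \<rightarrow>\<^sub>E UNIV. (\<Prod>i=0..<q. A $ r i $ f i) * minor B q f c)"
proof -
  have "minor (A ** B) q r c = (\<Sum>p | p permutes {0..<q}. signof p *
      (\<Prod>i=0..<q. \<Sum>k\<in>UNIV. A $ r i $ k * B $ k $ c (p i)))"
    by (simp add: minor_eq_sum_permutations matrix_matrix_mult_def)
  also have "\<dots> = (\<Sum>p | p permutes {0..<q}. \<Sum>f \<in> {0..<q} \<rightarrow>\<^sub>E UNIV.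
      (\<Prod>i=0..<q. A $ r i $ f i) * (signof p * (\<Prod>i=0..<q. B $ f i $ c (p i))))"
    by (simp add: prod_sum_PiE sum_distrib_left prod.distrib mult_ac)
  also have "\<dots> = (\<Sum>f \<in> {0..<q} \<rightarrow>\<^sub>E UNIV. \<Sum>p | p permutes {0..<q}.
      (\<Prod>i=0..<q. A $ r i $ f i) * (signof p * (\<Prod>i=0..<q. B $ f i $ c (p i))))"
    by (rule sum.swap)
  also have "\<dots> = (\<Sum>f \<in> {0..<q} \<rightarrow>\<^sub>E UNIV. (\<Prod>i=0..<q. A $ r i $ f i) * minor B q f c)"
    by (simp add: minor_eq_sum_permutations sum_distrib_left)
  finally show ?thesis .
qed

text \<open>
  The Cauchy--Binet formula, with the sum over all maps instead of the increasing ones: every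
  increasing map occurs \<open>fact q\<close> times up to a permutation, which changes both signs.
\<close>

lemma cauchy_binet_all_maps:
  fixes A :: "real ^ 'k::{finite,linorder} ^ 'm::{finite,linorder}"
    and B :: "real ^ 'n::{finite,linorder} ^ 'k::{finite,linorder}"
  shows "fact q * minor (A ** B) q r c
    = (\<Sum>f \<in> {0..<q} \<rightarrow>\<^sub>E UNIV. minor A q r f * minor B q f c)"
proof -
  let ?F = "{0..<q} \<rightarrow>\<^sub>E (UNIV :: 'k set)"
  \<comment> \<open>Replacing \<open>f\<close> by \<open>f \<circ> p\<close> permutes the index set
    of the sum and takes \<open>signof p\<close> out of the minor of \<open>B\<close>. Summed over
    \<open>p\<close>, the signs and the entries of \<open>A\<close> form the Leibniz sum of
    \<open>minor A q r f\<close>.\<close>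
  have perm: "minor (A ** B) q r c
      = (\<Sum>f\<in>?F. signof p * (\<Prod>i=0..<q. A $ r i $ f (p i)) * minor B q f c)"
    if p: "p permutes {0..<q}" for p
  proof -
    have "minor (A ** B) q r c
        = (\<Sum>f\<in>?F. (\<Prod>i=0..<q. A $ r i $ (f \<circ> p) i) * minor B q (f \<circ> p) c)"
      unfolding minor_matrix_mult
    proof (rule sum.reindex_bij_witness[where i = "\<lambda>f. f \<circ> p" and j = "\<lambda>f. f \<circ> inv_into UNIV p"])
      fix f assume f: "f \<in> ?F"
      show "(f \<circ> inv_into UNIV p) \<circ> p = f" "(f \<circ> p) \<circ> inv_into UNIV p = f"
        by (simp_all add: o_assoc[symmetric] permutes_inv_o[OF p])
      \<comment> \<open>\<open>p\<close> fixes everything outside \<open>{0..<q}\<close>, so the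
        compositions are still \<open>undefined\<close> there.\<close>
      show "f \<circ> inv_into UNIV p \<in> ?F" "f \<circ> p \<in> ?F"
        using f p permutes_inv[OF p] by (auto simp: PiE_iff extensional_def permutes_def)
    qed (simp add: o_assoc[symmetric] permutes_inv_o[OF p])
    then show ?thesis
      using p by (simp add: minor_permute_rows mult_ac)
  qed
  have "fact q * minor (A ** B) q r c = (\<Sum>p | p permutes {0..<q}. minor (A ** B) q r c)"
    by (simp add: card_permutations[of "{0..<q}" q])
  also have "\<dots> = (\<Sum>p | p permutes {0..<q}. \<Sum>f\<in>?F.
      signof p * (\<Prod>i=0..<q. A $ r i $ f (p i)) * minor B q f c)"
    by (intro sum.cong refl perm) simp
  also have "\<dots> = (\<Sum>f\<in>?F. \<Sum>p | p permutes {0..<q}.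
      signof p * (\<Prod>i=0..<q. A $ r i $ f (p i)) * minor B q f c)"
    by (rule sum.swap)
  also have "\<dots> = (\<Sum>f\<in>?F. minor A q r f * minor B q f c)"
    by (simp add: minor_eq_sum_permutations[of A] sum_distrib_right)
  finally show ?thesis .
qed

section \<open>Total nonnegativity of products\<close>

lemma inj_on_sort:
  fixes f :: "nat \<Rightarrow> 'a::linorder"
  assumes inj: "inj_on f {0..<q}"
  obtains s p where "strict_mono_on {..<q} s" "p permutes {0..<q}" "\<And>i. i < q \<Longrightarrow> f i = s (p i)"
proof -
  let ?l = "sorted_list_of_set (f ` {0..<q})"
  define s where "s i = ?l ! i" for i
  have len: "length ?l = q"
    using card_image[OF inj] by simp
  have smono: "strict_mono_on {..<q} s"
    using sorted_wrt_nth_less[OF strict_sorted_list_of_set[of "f ` {0..<q}"]] len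
    by (intro strict_mono_onI) (simp add: s_def)
  have "s ` {0..<q} = set ?l"
    unfolding s_def by (metis len atLeast0LessThan nth_image order_refl take_all)
  then have img: "s ` {0..<q} = f ` {0..<q}"
    by simp
  have sinj: "inj_on s {0..<q}"
    using smono strict_mono_on_imp_inj_on by (simp add: atLeast0LessThan)
  \<comment> \<open>\<open>p i\<close> is the rank of \<open>f i\<close> in the image of
    \<open>f\<close>; it is extended by the identity because \<open>permutes\<close> demands
    it.\<close>
  define p where "p i = (if i < q then inv_into {0..<q} s (f i) else i)" for i
  have fs: "f i = s (p i)" if "i < q" for i
    using that img by (simp add: p_def f_inv_into_f)
  have "inj_on p {0..<q}"
  proof (rule inj_onI)
    fix i j assume "i \<in> {0..<q}" "j \<in> {0..<q}" "p i = p j"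
    then show "i = j"
      using fs[of i] fs[of j] inj_onD[OF inj] by simp
  qed
  moreover have "p ` {0..<q} \<subseteq> {0..<q}"
    using img inv_into_into[of _ s "{0..<q}"] by (fastforce simp: p_def)
  ultimately have "bij_betw p {0..<q} {0..<q}"
    by (simp add: bij_betw_def endo_inj_surj)
  then have "p permutes {0..<q}"
    by (rule bij_imp_permutes) (simp add: p_def)
  from that[OF smono this fs] show thesis
    .
qed

text \<open>Sorting \<open>f\<close> multiplies both minors by the same sign, which cancels in the
  product; if \<open>f\<close> repeats a value, the minor of \<open>B\<close> vanishes.\<close>

lemma minor_mult_minor_nonneg:
  assumes "totally_nonnegative A" "totally_nonnegative B"
    and q: "1 \<le> q" and r: "strict_mono_on {..<q} r" and c: "strict_mono_on {..<q} c"
  shows "0 \<le> minor A q r f * minor B q f c"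
proof (cases "inj_on f {0..<q}")
  case True
  then obtain s p where s: "strict_mono_on {..<q} s" and p: "p permutes {0..<q}"
    and fs: "\<And>i. i < q \<Longrightarrow> f i = s (p i)"
    using inj_on_sort[OF True] by metis
  have "minor A q r f = signof p * minor A q r s" "minor B q f c = signof p * minor B q s c"
    using minor_permute_columns[OF p, of A r s] minor_permute_rows[OF p, of B s c]
      minor_cong[of q r r f "s \<circ> p" A] minor_cong[of q f "s \<circ> p" c c B] fs
    by simp_all
  moreover have "signof p * signof p = (1 :: real)"
    by (simp add: sign_def)
  ultimately have "minor A q r f * minor B q f c = minor A q r s * minor B q s c"
    by (simp add: sign_def)
  then show ?thesis
    using assms s by (simp add: totally_nonnegative_def)
qed (simp add: minor_not_inj_rows)

lemma totally_nonnegative_mult: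
  fixes A :: "real ^ 'k::{finite,linorder} ^ 'm::{finite,linorder}"
    and B :: "real ^ 'n::{finite,linorder} ^ 'k::{finite,linorder}"
  assumes "totally_nonnegative A" "totally_nonnegative B"
  shows "totally_nonnegative (A ** B)"
  unfolding totally_nonnegative_def
proof (intro allI impI)
  fix q :: nat and r :: "nat \<Rightarrow> 'm" and c :: "nat \<Rightarrow> 'n"
  assume "1 \<le> q \<and> strict_mono_on {..<q} r \<and> strict_mono_on {..<q} c"
  then have "0 \<le> fact q * minor (A ** B) q r c"
    unfolding cauchy_binet_all_maps using assms by (intro sum_nonneg minor_mult_minor_nonneg) auto
  then show "0 \<le> minor (A ** B) q r c"
    using mult_le_cancel_left_pos[of "fact q" 0 "minor (A ** B) q r c"] by simp
qed

text \<open>All terms of the Cauchy--Binet sum are nonnegative, so the positive term at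
  \<open>s\<close> suffices.\<close>

lemma minor_mult_pos:
  assumes tn: "totally_nonnegative A" "totally_nonnegative B"
    and q: "1 \<le> q" "strict_mono_on {..<q} r" "strict_mono_on {..<q} c"
    and s: "0 < minor A q r s" "0 < minor B q s c"
  shows "0 < minor (A ** B) q r c"
proof -
  \<comment> \<open>The sum runs over maps that are \<open>undefined\<close> outside
    \<open>{0..<q}\<close>, so \<open>s\<close> has to be cut off there.\<close>
  have "minor A q r (restrict s {0..<q}) = minor A q r s"
    "minor B q (restrict s {0..<q}) c = minor B q s c"
    by (auto intro: minor_cong)
  then have "0 < fact q * minor (A ** B) q r c"
    unfolding cauchy_binet_all_maps
    using s minor_mult_minor_nonneg[OF tn q]
    by (intro sum_pos2[where i = "restrict s {0..<q}"]) (auto intro: finite_PiE)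
  then show ?thesis
    by (simp add: zero_less_mult_iff)
qed

section \<open>Laplace expansion, continuants and zero blocks\<close>

lemma minor_expand_last_row:
  "minor A (Suc q) r c = (\<Sum>j<Suc q. A $ r q $ c j *
     ((-1) ^ (q + j) * minor A q r (\<lambda>k. if k < j then c k else c (Suc k))))"
proof -
  let ?M = "Matrix.mat (Suc q) (Suc q) (\<lambda>(i, j). A $ r i $ c j)"
  \<comment> \<open>Deleting column \<open>j\<close> is expressed by a column map that skips
    \<open>c j\<close>, so the cofactors are again minors of \<open>A\<close>.\<close>
  have "Determinant.mat_delete ?M q j
      = Matrix.mat q q (\<lambda>(i, k). A $ r i $ (if k < j then c k else c (Suc k)))" if "j < Suc q" for j
    using that by (intro eq_matI) (auto simp: mat_delete_def)
  then show ?thesis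
    unfolding minor_def
    by (subst laplace_expansion_row[of _ "Suc q" q])
      (auto simp: cofactor_def intro!: sum.cong simp del: sum.lessThan_Suc)
qed

lemma minor_last_row:
  assumes "\<And>j. j < q \<Longrightarrow> A $ r q $ c j = 0"
  shows "minor A (Suc q) r c = A $ r q $ c q * minor A q r c"
proof -
  have "minor A q r (\<lambda>k. if k < q then c k else c (Suc k)) = minor A q r c"
    by (rule minor_cong) auto
  then show ?thesis
    using assms by (simp add: minor_expand_last_row power_add[symmetric])
qed

lemma minor_last_column:
  assumes "\<And>i. i < q \<Longrightarrow> A $ r i $ c q = 0"
  shows "minor A (Suc q) r c = A $ r q $ c q * minor A q r c"
  using minor_last_row[of q "Finite_Cartesian_Product.transpose A" c r] assms
  by (simp add: minor_transpose) (simp add: Finite_Cartesian_Product.transpose_def)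

text \<open>Only the last two entries of the last row may be nonzero, and the cofactor of the left
  one has a last column with a single possibly nonzero entry.\<close>

lemma minor_continuant:
  assumes row: "\<And>j. j < q \<Longrightarrow> A $ r (Suc q) $ c j = 0"
    and column: "\<And>i. i < q \<Longrightarrow> A $ r i $ c (Suc q) = 0"
  shows "minor A (Suc (Suc q)) r c = A $ r (Suc q) $ c (Suc q) * minor A (Suc q) r c
    - A $ r (Suc q) $ c q * A $ r q $ c (Suc q) * minor A q r c"
proof -
  \<comment> \<open>\<open>c'\<close> omits column \<open>c q\<close>; hence
    \<open>c' q = c (Suc q)\<close>.\<close>
  define c' where "c' k = (if k < q then c k else c (Suc k))" for k
  have "minor A (Suc q) r (\<lambda>k. if k < Suc q then c k else c (Suc k)) = minor A (Suc q) r c"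
    by (rule minor_cong) auto
  moreover have "minor A q r c' = minor A q r c"
    by (rule minor_cong) (auto simp: c'_def)
  moreover have "minor A (Suc q) r c' = A $ r q $ c (Suc q) * minor A q r c'"
    using minor_last_column[of q A r c'] column by (simp add: c'_def)
  ultimately show ?thesis
    using row by (subst minor_expand_last_row) (simp add: c'_def[abs_def] power_add[symmetric])
qed

text \<open>A permutation avoiding the zero block would map \<open>k + 1\<close> rows injectively
  into \<open>k\<close> columns, so every Leibniz term has a zero factor.\<close>

lemma minor_zero_block:
  assumes k: "k < q" and zero: "\<And>i j. i \<le> k \<Longrightarrow> k \<le> j \<Longrightarrow> j < q \<Longrightarrow> A $ r i $ c j = 0"
  shows "minor A q r c = 0"
  unfolding minor_eq_sum_permutations
proof (rule sum.neutral, rule ballI)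
  fix p assume "p \<in> {p. p permutes {0..<q}}"
  then have p: "p permutes {0..<q}"
    by simp
  have "\<exists>i\<le>k. k \<le> p i"
  proof (rule ccontr)
    assume "\<not> (\<exists>i\<le>k. k \<le> p i)"
    then have "p ` {..k} \<subseteq> {..<k}"
      by auto
    from card_mono[OF _ this] show False
      using card_image[OF inj_on_subset[OF permutes_inj[OF p] subset_UNIV], of "{..k}"] by simp
  qed
  then obtain i where "i \<le> k" "k \<le> p i"
    by blast
  moreover have "p i < q"
    using permutes_in_image[OF p, of i] k \<open>i \<le> k\<close> by simp
  ultimately have "(\<Prod>i=0..<q. A $ r i $ c (p i)) = 0"
    using zero[of i "p i"] k by (intro prod_zero) (auto intro!: bexI[of _ i])
  then show "signof p * (\<Prod>i=0..<q. A $ r i $ c (p i)) = 0"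
    by simp
qed


section \<open>Index positions and tridiagonal matrices close to the identity\<close>

lemma pos_strict_mono: "i < j \<Longrightarrow> pos i < pos j"
  unfolding pos_def by (rule psubset_card_mono) auto

lemma pos_less_iff: "pos i < pos j \<longleftrightarrow> i < j"
  by (metis less_irrefl linorder_less_linear order.asym pos_strict_mono)

lemma pos_eq_iff: "pos i = pos j \<longleftrightarrow> i = j"
  by (metis less_irrefl linorder_less_linear pos_less_iff)

lemma pos_less_card: "pos (i :: 'n::{finite,linorder}) < CARD('n)"
  unfolding pos_def by (rule psubset_card_mono) auto

lemma pos_surj:
  assumes "k < CARD('n)"
  obtains i :: "'n::{finite,linorder}" where "pos i = k"
proof -
  have "inj_on pos (UNIV :: 'n set)"
    by (simp add: inj_on_def pos_eq_iff)
  then have "card (range (pos :: 'n \<Rightarrow> nat)) = card {..<CARD('n)}"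
    by (simp add: card_image)
  then have "range (pos :: 'n \<Rightarrow> nat) = {..<CARD('n)}"
    by (intro card_subset_eq) (auto simp: pos_less_card)
  then show thesis
    using assms that by (metis imageE lessThan_iff)
qed

text \<open>
  With these numerical bounds a continuant loses at most half of its value at each step.
\<close>

definition near_identity_jacobi :: "real ^ 'n::{finite,linorder} ^ 'n::{finite,linorder} \<Rightarrow> bool" where
  "near_identity_jacobi A \<longleftrightarrow> tridiagonal A \<and> (\<forall>i. 3 / 4 \<le> A $ i $ i) \<and>
     (\<forall>i j. i \<noteq> j \<longrightarrow> 0 \<le> A $ i $ j \<and> A $ i $ j \<le> 1 / 4)"

lemma near_identity_jacobi_nonneg:
  assumes "near_identity_jacobi A"
  shows "0 \<le> A $ i $ j"
proof (cases "i = j")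
  case True
  moreover have "3 / 4 \<le> A $ i $ i"
    using assms by (simp add: near_identity_jacobi_def)
  ultimately show ?thesis
    by simp
qed (use assms in \<open>simp add: near_identity_jacobi_def\<close>)

lemma near_identity_jacobi_eq_0:
  assumes "near_identity_jacobi A" and far: "pos i + 1 < pos j \<or> pos j + 1 < pos i"
  shows "A $ i $ j = 0"
proof -
  have "tridiagonal A"
    using assms(1) by (simp add: near_identity_jacobi_def)
  from this[unfolded tridiagonal_def, rule_format, OF far] show ?thesis .
qed

text \<open>Induction on the leading minors. If the last row and column indices agree, the
  continuant recursion applies; if they are neighbours, monotonicity leaves one possibly nonzero
  entry in the last row or column, and the minor factors.\<close>

lemma near_identity_jacobi_banded_minor:
  fixes A :: "real ^ 'n::{finite,linorder} ^ 'n::{finite,linorder}"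
  assumes A: "near_identity_jacobi A"
    and r: "strict_mono_on {..<q} r" and c: "strict_mono_on {..<q} c"
    and band: "\<And>i. i < q \<Longrightarrow> pos (r i) \<le> pos (c i) + 1 \<and> pos (c i) \<le> pos (r i) + 1"
  shows "0 \<le> minor A q r c"
    and "(\<And>i. i < q \<Longrightarrow> 0 < A $ r i $ c i) \<Longrightarrow> 0 < minor A q r c"
proof -
  have rm: "pos (r i) < pos (r j)" and cm: "pos (c i) < pos (c j)" if "i < j" "j < q" for i j
    using r c that by (auto simp: strict_mono_on_def pos_less_iff)
  \<comment> \<open>Two consecutive orders are carried along because the recursion has three terms.
    The bound by half needs \<open>r m = c m\<close>, since otherwise the new factor is an
    off-diagonal entry of \<open>A\<close>, without a positive lower bound.\<close>
  have "Suc m \<le> q \<Longrightarrow> 0 \<le> minor A m r c \<and> 0 \<le> minor A (Suc m) r c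
      \<and> (r m = c m \<longrightarrow> minor A m r c / 2 \<le> minor A (Suc m) r c)
      \<and> ((\<forall>i\<le>m. 0 < A $ r i $ c i) \<longrightarrow> 0 < minor A m r c \<and> 0 < minor A (Suc m) r c)" for m
  proof (induction m)
    case 0
    have one: "minor A 0 r c = 1"
      by (simp add: minor_def)
    moreover have "minor A (Suc 0) r c = A $ r 0 $ c 0"
      using minor_last_row[of 0 A r c] one by simp
    moreover have "r 0 = c 0 \<Longrightarrow> 3 / 4 \<le> A $ r 0 $ c 0"
      using A by (simp add: near_identity_jacobi_def)
    ultimately show ?case
      using near_identity_jacobi_nonneg[OF A, of "r 0" "c 0"] by auto
  next
    case (Suc m)
    let ?a = "A $ r (Suc m) $ c (Suc m)"
    have IH: "0 \<le> minor A m r c" "0 \<le> minor A (Suc m) r c"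
      "r m = c m \<Longrightarrow> minor A m r c / 2 \<le> minor A (Suc m) r c"
      "(\<forall>i\<le>m. 0 < A $ r i $ c i) \<Longrightarrow> 0 < minor A (Suc m) r c"
      using Suc by auto
    have m: "Suc m < q" "m < q"
      using Suc.prems by auto
    consider (diag) "pos (r (Suc m)) = pos (c (Suc m))"
      | (lower) "pos (r (Suc m)) = pos (c (Suc m)) + 1"
      | (upper) "pos (c (Suc m)) = pos (r (Suc m)) + 1"
      using band[OF m(1)] by linarith
    then show ?case
    proof cases
      case diag
      then have eq: "r (Suc m) = c (Suc m)"
        by (simp add: pos_eq_iff)
      then have a: "3 / 4 \<le> ?a"
        using A by (simp add: near_identity_jacobi_def)
      let ?b = "A $ r (Suc m) $ c m * A $ r m $ c (Suc m)"
      have "minor A (Suc (Suc m)) r c = ?a * minor A (Suc m) r c - ?b * minor A m r c"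
      proof (rule minor_continuant)
        fix j assume "j < m"
        then have "pos (c j) < pos (c m)" "pos (c m) < pos (c (Suc m))"
          and "pos (r j) < pos (r m)" "pos (r m) < pos (r (Suc m))"
          using cm[of j m] cm[of m "Suc m"] rm[of j m] rm[of m "Suc m"] m by auto
        with diag show "A $ r (Suc m) $ c j = 0" "A $ r j $ c (Suc m) = 0"
          by (auto intro!: near_identity_jacobi_eq_0[OF A])
      qed
      moreover have "?b * minor A m r c \<le> minor A (Suc m) r c / 4"
      proof (cases "?b = 0")
        case True
        then show ?thesis
          using IH(2) by (simp only: mult_zero_left)
      next
        case False
        \<comment> \<open>If the subtracted term has a nonzero coefficient, \<open>r m\<close> and
          \<open>c m\<close> both lie immediately below the common last index. So they coincide, and
          the bound by half is available.\<close>
        have "\<not> pos (c m) + 1 < pos (r (Suc m))" "\<not> pos (r m) + 1 < pos (c (Suc m))"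
          using False near_identity_jacobi_eq_0[OF A] by auto
        moreover have "pos (c m) < pos (c (Suc m))" "pos (r m) < pos (r (Suc m))"
          using cm[of m "Suc m"] rm[of m "Suc m"] m by auto
        ultimately have "r m = c m" and off: "r (Suc m) \<noteq> c m" "r m \<noteq> c (Suc m)"
          using diag by (auto simp: pos_eq_iff[symmetric])
        have "?b \<le> (1 / 4) * (1 / 4)"
          using A off unfolding near_identity_jacobi_def by (intro mult_mono) auto
        \<comment> \<open>The coefficient 1/16 is relaxed to 1/8, which the bound by half turns into
          a quarter of \<open>minor A (Suc m) r c\<close>. Subtracted from the 3/4 due to the
          diagonal entry, it leaves a half.\<close>
        then have "?b * minor A m r c \<le> (1 / 8) * minor A m r c"
          using IH(1) by (intro mult_right_mono) auto
        then show ?thesis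
          using IH(3)[OF \<open>r m = c m\<close>] by simp
      qed
      moreover have "3 / 4 * minor A (Suc m) r c \<le> ?a * minor A (Suc m) r c"
        using a IH(2) by (rule mult_right_mono)
      ultimately have "minor A (Suc m) r c / 2 \<le> minor A (Suc (Suc m)) r c"
        by linarith
      then show ?thesis
        using IH by force
    next
      case lower
      \<comment> \<open>All earlier columns lie at least two positions below row
        \<open>r (Suc m)\<close> and meet it in zeros.\<close>
      have "minor A (Suc (Suc m)) r c = ?a * minor A (Suc m) r c"
      proof (rule minor_last_row)
        fix j assume "j < Suc m"
        then show "A $ r (Suc m) $ c j = 0"
          using cm[of j "Suc m"] m lower by (intro near_identity_jacobi_eq_0[OF A]) auto
      qed
      then show ?thesis
        using IH lower near_identity_jacobi_nonneg[OF A] by auto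
    next
      case upper
      have "minor A (Suc (Suc m)) r c = ?a * minor A (Suc m) r c"
      proof (rule minor_last_column)
        fix j assume "j < Suc m"
        then show "A $ r j $ c (Suc m) = 0"
          using rm[of j "Suc m"] m upper by (intro near_identity_jacobi_eq_0[OF A]) auto
      qed
      then show ?thesis
        using IH upper near_identity_jacobi_nonneg[OF A] by auto
    qed
  qed
  note step = this
  show "0 \<le> minor A q r c"
    using step[of "q - 1"] by (cases q) (auto simp: minor_def)
  show "0 < minor A q r c" if "\<And>i. i < q \<Longrightarrow> 0 < A $ r i $ c i"
    using step[of "q - 1"] that by (cases q) (auto simp: minor_def)
qed

text \<open>If \<open>r k\<close> and \<open>c k\<close> are more than one position apart,
  monotonicity spreads the gap to all rows up to \<open>k\<close> and columns from \<open>k\<close>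
  on, or the reverse, and creates a zero block.\<close>

lemma totally_nonnegative_near_identity_jacobi:
  fixes A :: "real ^ 'n::{finite,linorder} ^ 'n::{finite,linorder}"
  assumes A: "near_identity_jacobi A"
  shows "totally_nonnegative A"
  unfolding totally_nonnegative_def
proof (intro allI impI, elim conjE)
  fix q :: nat and r c :: "nat \<Rightarrow> 'n"
  assume r: "strict_mono_on {..<q} r" and c: "strict_mono_on {..<q} c"
  have rm: "pos (r i) \<le> pos (r j)" and cm: "pos (c i) \<le> pos (c j)" if "i \<le> j" "j < q" for i j
    using r c that
    by (auto simp: strict_mono_on_def pos_less_iff le_less dest!: le_imp_less_or_eq)
  show "0 \<le> minor A q r c"
  proof (cases "\<forall>i<q. pos (r i) \<le> pos (c i) + 1 \<and> pos (c i) \<le> pos (r i) + 1")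
    case True
    then show ?thesis
      using near_identity_jacobi_banded_minor(1)[OF A r c] by blast
  next
    case False
    then obtain k where k: "k < q"
      and far: "pos (r k) + 1 < pos (c k) \<or> pos (c k) + 1 < pos (r k)"
      by (auto simp: not_le)
    from far have "minor A q r c = 0"
    proof
      assume *: "pos (r k) + 1 < pos (c k)"
      show ?thesis
      proof (rule minor_zero_block[OF k])
        fix i j assume "i \<le> k" "k \<le> j" "j < q"
        then show "A $ r i $ c j = 0"
          using * rm[of i k] cm[of k j] k by (intro near_identity_jacobi_eq_0[OF A]) auto
      qed
    next
      assume *: "pos (c k) + 1 < pos (r k)"
      \<comment> \<open>Transposing moves the zero block from the lower left to the upper right
        corner, as \<open>minor_zero_block\<close> expects.\<close>
      have "minor (Finite_Cartesian_Product.transpose A) q c r = 0"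
      proof (rule minor_zero_block[OF k])
        fix i j assume "i \<le> k" "k \<le> j" "j < q"
        then have "A $ r j $ c i = 0"
          using * cm[of i k] rm[of k j] k by (intro near_identity_jacobi_eq_0[OF A]) auto
        then show "Finite_Cartesian_Product.transpose A $ c i $ r j = 0"
          by (simp add: Finite_Cartesian_Product.transpose_def)
      qed
      then show ?thesis
        by (simp add: minor_transpose)
    qed
    then show ?thesis
      by simp
  qed
qed

lemma near_identity_jacobi_mat_1:
  "near_identity_jacobi (Finite_Cartesian_Product.mat 1 :: real ^ 'n::{finite,linorder} ^ 'n::{finite,linorder})"
  by (auto simp: near_identity_jacobi_def tridiagonal_def Finite_Cartesian_Product.mat_def)

section \<open>Total positivity of sufficiently long products\<close>

lemma totally_nonnegative_mat_prod:
  assumes "\<And>i. i \<in> {1..p} \<Longrightarrow> near_identity_jacobi (A i)"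
  shows "totally_nonnegative (mat_prod A p)"
  using assms
proof (induction p)
  case 0
  show ?case
    by (simp add: totally_nonnegative_near_identity_jacobi near_identity_jacobi_mat_1)
next
  case (Suc p)
  then have "totally_nonnegative (A (Suc p) ** mat_prod A p)"
    using totally_nonnegative_near_identity_jacobi by (intro totally_nonnegative_mult) auto
  then show ?case
    by simp
qed

text \<open>Provides the intermediate indices for splitting one factor off a product: each index
  moves one position towards its target, or rests once it is there.\<close>

lemma strict_mono_on_step_towards:
  fixes r c :: "nat \<Rightarrow> 'n::{finite,linorder}"
  assumes r: "strict_mono_on {..<q} r" and c: "strict_mono_on {..<q} c"
    and dist: "\<And>i. i < q \<Longrightarrow> pos (r i) \<le> pos (c i) + Suc p \<and> pos (c i) \<le> pos (r i) + Suc p"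
  obtains s :: "nat \<Rightarrow> 'n" where "strict_mono_on {..<q} s"
    "\<And>i. i < q \<Longrightarrow> pos (r i) \<le> pos (s i) + 1 \<and> pos (s i) \<le> pos (r i) + 1"
    "\<And>i. i < q \<Longrightarrow> pos (s i) \<le> pos (c i) + p \<and> pos (c i) \<le> pos (s i) + p"
proof -
  define t where "t i = (if pos (r i) < pos (c i) then pos (r i) + 1
    else if pos (c i) < pos (r i) then pos (r i) - 1 else pos (r i))" for i
  have "\<exists>x :: 'n. pos x = t i" for i
  proof -
    have "t i < CARD('n)"
      using pos_less_card[of "r i"] pos_less_card[of "c i"] by (auto simp: t_def)
    then show ?thesis
      by (metis pos_surj)
  qed
  then obtain s :: "nat \<Rightarrow> 'n" where s: "pos (s i) = t i" for i
    by metis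
  have "strict_mono_on {..<q} s"
  proof (rule strict_mono_onI)
    fix i j assume "i \<in> {..<q}" "j \<in> {..<q}" "i < j"
    then have "pos (r i) < pos (r j)" "pos (c i) < pos (c j)"
      using r c by (auto simp: strict_mono_on_def pos_less_iff)
    \<comment> \<open>If the gap between \<open>i\<close> and \<open>j\<close> shrinks, their
      targets separate them: \<open>t i \<le> pos (c i) < pos (c j) \<le> t j\<close>. Otherwise the
      gap between \<open>r i\<close> and \<open>r j\<close> persists.\<close>
    then have "t i < t j"
      by (auto simp: t_def)
    then show "s i < s j"
      by (simp add: s[symmetric] pos_less_iff)
  qed
  moreover have "pos (r i) \<le> pos (s i) + 1 \<and> pos (s i) \<le> pos (r i) + 1" for i
    by (auto simp: s t_def)
  moreover have "pos (s i) \<le> pos (c i) + p \<and> pos (c i) \<le> pos (s i) + p" if "i < q" for i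
    using dist[OF that] by (auto simp: s t_def)
  ultimately show thesis
    using that by blast
qed

text \<open>The leftmost factor pays for one move from \<open>r\<close> to \<open>s\<close>, the
  remaining factors for the way from \<open>s\<close> to \<open>c\<close>; this gives one positive
  Cauchy--Binet term.\<close>

lemma minor_mat_prod_pos:
  fixes A :: "nat \<Rightarrow> real ^ 'n::{finite,linorder} ^ 'n::{finite,linorder}"
  assumes A: "\<And>i. i \<in> {1..p} \<Longrightarrow> near_identity_jacobi (A i) \<and> pos_off_diagonals (A i)"
    and q: "1 \<le> q" and r: "strict_mono_on {..<q} r" and c: "strict_mono_on {..<q} c"
    and dist: "\<And>i. i < q \<Longrightarrow> pos (r i) \<le> pos (c i) + p \<and> pos (c i) \<le> pos (r i) + p"
  shows "0 < minor (mat_prod A p) q r c"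
  using A r c dist
proof (induction p arbitrary: r)
  case 0
  have "r i = c i" if "i < q" for i
    using "0.prems"(4)[OF that] by (simp add: pos_eq_iff[symmetric])
  then show ?case
    using near_identity_jacobi_banded_minor(2)[OF near_identity_jacobi_mat_1 "0.prems"(2,3)]
    by (simp add: Finite_Cartesian_Product.mat_def)
next
  case (Suc p)
  obtain s :: "nat \<Rightarrow> 'n" where s: "strict_mono_on {..<q} s"
    and rs: "\<And>i. i < q \<Longrightarrow> pos (r i) \<le> pos (s i) + 1 \<and> pos (s i) \<le> pos (r i) + 1"
    and sc: "\<And>i. i < q \<Longrightarrow> pos (s i) \<le> pos (c i) + p \<and> pos (c i) \<le> pos (s i) + p"
    using strict_mono_on_step_towards[OF Suc.prems(2,3,4)] by blast
  have B: "near_identity_jacobi (A (Suc p))" "pos_off_diagonals (A (Suc p))"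
    using Suc.prems(1) by auto
  \<comment> \<open>A single move uses a diagonal entry or one next to the diagonal, so the
    submatrix has a positive diagonal.\<close>
  have "0 < A (Suc p) $ r i $ s i" if i: "i < q" for i
  proof -
    consider "pos (r i) = pos (s i)" | "pos (r i) = pos (s i) + 1" | "pos (s i) = pos (r i) + 1"
      using rs[OF i] by linarith
    then show ?thesis
    proof cases
      case 1
      then have "3 / 4 \<le> A (Suc p) $ r i $ s i"
        using B(1) by (simp add: near_identity_jacobi_def pos_eq_iff)
      then show ?thesis
        by linarith
    qed (use B(2) in \<open>unfold pos_off_diagonals_def, blast+\<close>)
  qed
  then have "0 < minor (A (Suc p)) q r s"
    using near_identity_jacobi_banded_minor(2)[OF B(1) Suc.prems(2) s] rs by blast
  moreover have "0 < minor (mat_prod A p) q s c"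
  proof (rule Suc.IH[OF _ s Suc.prems(3) sc])
    show "near_identity_jacobi (A i) \<and> pos_off_diagonals (A i)" if "i \<in> {1..p}" for i
      using that by (intro Suc.prems(1)) simp
  qed
  moreover have "totally_nonnegative (mat_prod A p)"
    using Suc.prems(1) by (intro totally_nonnegative_mat_prod) simp
  ultimately have "0 < minor (A (Suc p) ** mat_prod A p) q r c"
    using minor_mult_pos[OF totally_nonnegative_near_identity_jacobi[OF B(1)] _ q Suc.prems(2,3)]
    by blast
  then show ?case
    by simp
qed

text \<open>No two positions are more than \<open>CARD('n) - 1\<close> apart, so \<open>p\<close>
  moves reach every choice of columns.\<close>

lemma totally_positive_mat_prod:
  fixes A :: "nat \<Rightarrow> real ^ 'n::{finite,linorder} ^ 'n::{finite,linorder}"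
  assumes "\<And>i. i \<in> {1..p} \<Longrightarrow> near_identity_jacobi (A i) \<and> pos_off_diagonals (A i)"
    and "CARD('n) \<le> Suc p"
  shows "totally_positive (mat_prod A p)"
  unfolding totally_positive_def
proof (intro allI impI, elim conjE)
  fix q :: nat and r c :: "nat \<Rightarrow> 'n"
  assume "1 \<le> q" "strict_mono_on {..<q} r" "strict_mono_on {..<q} c"
  moreover have "pos i \<le> pos j + p" for i j :: 'n
    using pos_less_card[of i] assms(2) by linarith
  ultimately show "0 < minor (mat_prod A p) q r c"
    using assms(1) by (intro minor_mat_prod_pos) auto
qed

lemma oscillatory_near_identity_jacobi:
  fixes A :: "real ^ 'n::{finite,linorder} ^ 'n::{finite,linorder}"
  assumes "near_identity_jacobi A" "pos_off_diagonals A"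
  shows "oscillatory A"
  unfolding oscillatory_def
\<comment> \<open>For a single index \<open>CARD('n) - 1\<close> would be 0, but the exponent must
  be at least 1.\<close>
proof (intro conjI exI[of _ "CARD('n)"])
  show "totally_positive (mat_pow A (CARD('n)))"
    using assms by (intro totally_positive_mat_prod) auto
qed (use assms totally_nonnegative_near_identity_jacobi in \<open>auto simp: Suc_le_eq\<close>)

section \<open>Mean Jacobians of the Euler discretization\<close>

lemma integral_component_cart2:
  fixes g :: "real \<Rightarrow> real ^ 'n ^ 'm"
  assumes "g integrable_on S"
  shows "integral S g $ i $ j = integral S (\<lambda>x. g x $ i $ j)"
proof -
  have "bounded_linear (\<lambda>M :: real ^ 'n ^ 'm. M $ i $ j)"
    by (intro bounded_linear_compose[OF bounded_linear_vec_nth bounded_linear_vec_nth])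
  from integral_linear[OF assms this] show ?thesis
    by (simp add: o_def)
qed

lemma integral_01_ge:
  fixes g :: "real \<Rightarrow> real"
  assumes "continuous_on {0..1} g" "\<And>x. x \<in> {0..1} \<Longrightarrow> l \<le> g x"
  shows "l \<le> integral {0..1} g"
  using integral_le[of "\<lambda>_. l" "{0..1}" "g"] integrable_continuous_interval[OF assms(1)] assms(2)
    integrable_const_ivl[of l 0 1]
  by simp

lemma integral_01_le:
  fixes g :: "real \<Rightarrow> real"
  assumes "continuous_on {0..1} g" "\<And>x. x \<in> {0..1} \<Longrightarrow> g x \<le> u"
  shows "integral {0..1} g \<le> u"
  using integral_le[of "g" "{0..1}" "\<lambda>_. u"] integrable_continuous_interval[OF assms(1)] assms(2)
    integrable_const_ivl[of u 0 1]
  by simp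

text \<open>On the compact interval \<open>g\<close> attains its minimum, which is a positive
  uniform lower bound.\<close>

lemma integral_01_pos:
  fixes g :: "real \<Rightarrow> real"
  assumes g: "continuous_on {0..1} g" and pos: "\<And>x. x \<in> {0..1} \<Longrightarrow> 0 < g x"
  shows "0 < integral {0..1} g"
proof -
  obtain m where m: "m \<in> {0..1}" "\<And>x. x \<in> {0..1} \<Longrightarrow> g m \<le> g x"
    using continuous_attains_inf[OF _ _ g] by auto
  then have "g m \<le> integral {0..1} g"
    using integral_01_ge[OF g] m(2) by blast
  then show ?thesis
    using pos[OF m(1)] by linarith
qed

text \<open>All conditions are bounds on single entries, and averaging over an interval of length 1
  preserves them.\<close>

lemma near_identity_jacobi_integral:
  fixes G :: "real \<Rightarrow> real ^ 'n::{finite,linorder} ^ 'n::{finite,linorder}"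
  assumes cont: "continuous_on {0..1} G"
    and G: "\<And>x. x \<in> {0..1} \<Longrightarrow> near_identity_jacobi (G x) \<and> pos_off_diagonals (G x)"
  shows "near_identity_jacobi (integral {0..1} G)" "pos_off_diagonals (integral {0..1} G)"
proof -
  have int: "integral {0..1} G $ i $ j = integral {0..1} (\<lambda>x. G x $ i $ j)" for i j
    using cont by (intro integral_component_cart2 integrable_continuous_interval)
  have c: "continuous_on {0..1} (\<lambda>x. G x $ i $ j)" for i j
    using cont by (intro continuous_intros)
  have "integral {0..1} G $ i $ j = 0" if "pos i + 1 < pos j \<or> pos j + 1 < pos i" for i j
  proof -
    have "G x $ i $ j = 0" if "x \<in> {0..1}" for x
      using G[OF that] near_identity_jacobi_eq_0 \<open>pos i + 1 < pos j \<or> pos j + 1 < pos i\<close> by blast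
    then have "integral {0..1} (\<lambda>x. G x $ i $ j) = integral {0..1} (\<lambda>_ :: real. 0)"
      by (rule Henstock_Kurzweil_Integration.integral_cong)
    then show ?thesis
      by (simp add: int)
  qed
  then have "tridiagonal (integral {0..1} G)"
    by (auto simp: tridiagonal_def)
  moreover have "3 / 4 \<le> integral {0..1} G $ i $ i" for i
    unfolding int using G by (intro integral_01_ge[OF c]) (auto simp: near_identity_jacobi_def)
  moreover have "0 \<le> integral {0..1} G $ i $ j \<and> integral {0..1} G $ i $ j \<le> 1 / 4"
    if "i \<noteq> j" for i j
    unfolding int using G that
    by (intro conjI integral_01_ge[OF c] integral_01_le[OF c])
      (auto simp: near_identity_jacobi_def)
  ultimately show "near_identity_jacobi (integral {0..1} G)"
    by (simp add: near_identity_jacobi_def)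
  show "pos_off_diagonals (integral {0..1} G)"
    using G unfolding pos_off_diagonals_def int by (auto intro!: integral_01_pos[OF c])
qed

text \<open>Smallness of \<open>\<epsilon> * M\<close> yields the bounds 3/4 and 1/4; nonnegativity
  off the diagonal comes from the sign pattern in \<open>tri\<close> and \<open>off\<close>.\<close>

lemma near_identity_jacobi_euler:
  fixes f :: "real \<Rightarrow> real ^ 'n::{finite,linorder} \<Rightarrow> real ^ 'n::{finite,linorder}"
  assumes M: "norm (jacobian (f (real k)) (at a)) \<le> M" and e: "0 < \<epsilon>" "\<epsilon> * M \<le> 1 / 4"
    and tri: "tridiagonal (euler_jacobian \<epsilon> f k a)"
    and off: "pos_off_diagonals (euler_jacobian \<epsilon> f k a)"
  shows "near_identity_jacobi (euler_jacobian \<epsilon> f k a)"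
proof -
  let ?J = "jacobian (f (real k)) (at a)"
  have small: "\<bar>\<epsilon> * ?J $ i $ j\<bar> \<le> 1 / 4" for i j
  proof -
    have "\<bar>?J $ i $ j\<bar> \<le> M"
      using component_le_norm_cart[of "?J $ i" j] Finite_Cartesian_Product.norm_nth_le[of ?J i] M
      by linarith
    then have "\<epsilon> * \<bar>?J $ i $ j\<bar> \<le> \<epsilon> * M"
      using e(1) by (intro mult_left_mono) auto
    also have "\<dots> \<le> 1 / 4"
      by (rule e(2))
    finally have "\<epsilon> * \<bar>?J $ i $ j\<bar> \<le> 1 / 4" .
    then show ?thesis
      using e(1) by (simp add: abs_mult)
  qed
  have entry: "euler_jacobian \<epsilon> f k a $ i $ j = (if i = j then 1 else 0) + \<epsilon> * ?J $ i $ j" for i j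
    by (simp add: euler_jacobian_def Finite_Cartesian_Product.mat_def)
  have "0 \<le> euler_jacobian \<epsilon> f k a $ i $ j" if "i \<noteq> j" for i j
  proof -
    have "pos i \<noteq> pos j"
      using that by (simp add: pos_eq_iff)
    then consider "pos j = pos i + 1" | "pos i = pos j + 1"
      | "pos i + 1 < pos j \<or> pos j + 1 < pos i"
      by linarith
    then show ?thesis
      using tri off by cases (auto simp: tridiagonal_def pos_off_diagonals_def less_imp_le)
  qed
  moreover have "3 / 4 \<le> euler_jacobian \<epsilon> f k a $ i $ i" for i
    using small[of i i] by (simp add: entry abs_le_iff)
  moreover have "euler_jacobian \<epsilon> f k a $ i $ j \<le> 1 / 4" if "i \<noteq> j" for i j
    using small[of i j] that by (simp add: entry abs_le_iff)
  ultimately show ?thesis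
    using tri by (simp add: near_identity_jacobi_def)
qed

theorem lemma2:
  fixes f :: "real \<Rightarrow> real ^ ('n::{finite,linorder}) \<Rightarrow> real ^ ('n::{finite,linorder})"
    and \<Omega> :: "(real ^ ('n::{finite,linorder})) set"
  assumes "C1_in_state f"
    and "compact \<Omega>" and "convex \<Omega>"
    and "jacobian_bounded_on f \<Omega>"
  shows "\<exists>\<epsilon>\<^sub>0>0. \<forall>\<epsilon>. 0 < \<epsilon> \<and> \<epsilon> < \<epsilon>\<^sub>0 \<longrightarrow>
           euler_evolves_on \<epsilon> f \<Omega> \<longrightarrow>
           (\<forall>k. \<forall>a\<in>\<Omega>. tridiagonal (euler_jacobian \<epsilon> f k a) \<and>
                        pos_off_diagonals (euler_jacobian \<epsilon> f k a)) \<longrightarrow>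
           ODTS (CARD('n) - 1) \<Omega> (euler_mean_jacobian \<epsilon> f)"
proof -
  obtain M where "0 < M" and M: "\<And>k a. a \<in> \<Omega> \<Longrightarrow> norm (jacobian (f (real k)) (at a)) \<le> M"
    using assms(4) unfolding jacobian_bounded_on_def bounded_pos by blast
  show ?thesis
  \<comment> \<open>\<open>M\<close> bounds the Jacobians at all times at once, so one threshold
    serves every \<open>k\<close>; it ensures \<open>\<epsilon> * M \<le> 1 / 4\<close>.\<close>
  proof (intro exI[of _ "1 / (4 * M)"] conjI allI impI)
    show "0 < 1 / (4 * M)"
      using \<open>0 < M\<close> by simp
    fix \<epsilon> assume e: "0 < \<epsilon> \<and> \<epsilon> < 1 / (4 * M)"
      and J: "\<forall>k. \<forall>a\<in>\<Omega>. tridiagonal (euler_jacobian \<epsilon> f k a) \<and>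
        pos_off_diagonals (euler_jacobian \<epsilon> f k a)"
    have eM: "\<epsilon> * M \<le> 1 / 4"
      using e \<open>0 < M\<close> by (simp add: field_simps)
    have F: "near_identity_jacobi (euler_mean_jacobian \<epsilon> f k a b)"
      "pos_off_diagonals (euler_mean_jacobian \<epsilon> f k a b)" if "a \<in> \<Omega>" "b \<in> \<Omega>" for k a b
    proof -
      let ?x = "\<lambda>r. r *\<^sub>R a + (1 - r) *\<^sub>R b"
      \<comment> \<open>By convexity the segment of integration stays in \<open>\<Omega>\<close>,
        where the assumptions on the Jacobian hold.\<close>
      have x: "?x r \<in> \<Omega>" if "r \<in> {0..1}" for r
        using convexD[OF \<open>convex \<Omega>\<close> \<open>a \<in> \<Omega>\<close> \<open>b \<in> \<Omega>\<close>, of r "1 - r"] that by simp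
      have "continuous_on UNIV (\<lambda>x. jacobian (f (real k)) (at x))"
        using assms(1) by (simp add: C1_in_state_def)
      then have "continuous_on {0..1} (\<lambda>r. jacobian (f (real k)) (at (?x r)))"
        by (rule continuous_on_compose2) (auto intro!: continuous_intros)
      then have "continuous_on {0..1} (\<lambda>r. euler_jacobian \<epsilon> f k (?x r))"
        unfolding euler_jacobian_def by (intro continuous_intros)
      moreover have "near_identity_jacobi (euler_jacobian \<epsilon> f k (?x r)) \<and>
          pos_off_diagonals (euler_jacobian \<epsilon> f k (?x r))" if "r \<in> {0..1}" for r
        using J x[OF that] e by (auto intro!: near_identity_jacobi_euler[OF _ _ eM] M)
      ultimately show "near_identity_jacobi (euler_mean_jacobian \<epsilon> f k a b)"
        "pos_off_diagonals (euler_mean_jacobian \<epsilon> f k a b)"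
        unfolding euler_mean_jacobian_def
        using near_identity_jacobi_integral[of "\<lambda>r. euler_jacobian \<epsilon> f k (?x r)"] by blast+
    qed
    show "ODTS (CARD('n) - 1) \<Omega> (euler_mean_jacobian \<epsilon> f)"
      unfolding ODTS_def using F
      by (auto intro!: oscillatory_near_identity_jacobi totally_positive_mat_prod)
  qed
qed

end
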